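(* Let $\Theta=[-1/2,1/2]$, let the source model $\mathcal{U}$ have densities $u(x;\theta)=\mathbf{1}\{\theta-1/2\le x\le\theta+1/2\}$ on $\mathbb{X}=[-1,1]$, and let the target model $\mathcal{V}$ have densities $v(y;\theta)$ on $\mathbb{Y}$. Let $\theta_0\in[-1/2,1/2]$ and suppose that for each $y\in\mathbb{Y}$, $v(y;\theta)$ is a continuous function of $\theta\in\Theta$ and $\nabla_\theta v(y;\theta)$ exists for all $\theta\in[-1/2,\theta_0)\cup(\theta_0,1/2]$. Let $g^+,g^-:\mathbb{Y}\to\mathbb{R}$ be two functions satisfying, for all $y \in \mathbb{Y}$, $$g^+(y)(1-2\theta_0)+g^-(y)(1+2\theta_0)=2v(y;1/2)+2v(y;-1/2)-2v(y;\theta_0).$$ Then the signed kernel $$\mathcal{S}^*(y|x)=\begin{cases}g^-(y)&\text{for all }x\le\theta_0-1/2,\\ g^+(y)-\nabla_\theta v(y;\theta)|_{\theta=x+1/2}&\text{for all }-1/2+\theta_0<x\le0,\\ \nabla_\theta v(y;\theta)|_{\theta=x-1/2}+g^-(y)&\text{for all }0<x<1/2+\theta_0,\\ g^+(y)&\text{for all }x\ge1/2+\theta_0\end{cases}$$ attains $\varsigma(\mathcal{U},\mathcal{V};\mathcal{S}^* )=0$.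
   Context: $\mathbb{Y}$ is a measurable subset of a Euclidean space and densities are with respect to Lebesgue measure. Derivatives at the endpoints $\pm1/2$ are one-sided. A signed kernel with density $\mathcal{S}(y|x)$ assigns to each $x\in\mathbb{X}$ the signed measure $\mathcal{S}(y|x)\,\mathrm{d}y$ on $\mathbb{Y}$. The signed deficiency is $$\varsigma(\mathcal{U},\mathcal{V};\mathcal{S})=\sup_{\theta\in\Theta}\frac12\int_{\mathbb{Y}}\Big|v(y;\theta)-\int_{\mathbb{X}}\mathcal{S}(y|x)\,u(x;\theta)\,\mathrm{d}x\Big|\,\mathrm{d}y.$$ Standing convention: $\mathcal{S}^*$ is a well-defined (jointly measurable) signed kernel and, for each $y$, $x\mapsto\mathcal{S}^*(y|x)$ is Lebesgue integrable on $[-1,1]$, so that the integrals above make sense. *)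

theory Defs
  imports "HOL-Analysis.Analysis"
begin

text \<open>
  Densities are taken with respect to Lebesgue measure on a measurable subset of a Euclidean space.
  The argument order follows the notation: \<open>f x \<theta>\<close> is \<open>f(x;\<theta>)\<close> and \<open>S y x\<close> is \<open>S(y|x)\<close>.
\<close>

definition density_model ::
    "'t set \<Rightarrow> 'a::euclidean_space set \<Rightarrow> ('a \<Rightarrow> 't \<Rightarrow> real) \<Rightarrow> bool" where
  "density_model \<Theta> X f \<longleftrightarrow>
     X \<in> sets lebesgue \<and>
     (\<forall>\<theta>\<in>\<Theta>. (\<forall>x\<in>X. 0 \<le> f x \<theta>) \<and> has_bochner_integral (lebesgue_on X) (\<lambda>x. f x \<theta>) 1)"

text \<open>
  The last condition says that \<open>S(y|x) dy\<close> is a signed measure on \<open>Y\<close>. As usual, a signed measure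
  may take at most one of the values \<open>\<infinity>\<close> and \<open>-\<infinity>\<close>, so only one of the
  positive and negative parts of the density has to have a finite integral.
\<close>

definition signed_kernel ::
    "'a::euclidean_space set \<Rightarrow> 'b::euclidean_space set \<Rightarrow> ('b \<Rightarrow> 'a \<Rightarrow> real) \<Rightarrow> bool" where
  "signed_kernel X Y S \<longleftrightarrow>
     (\<lambda>(y, x). S y x) \<in> borel_measurable (lebesgue_on Y \<Otimes>\<^sub>M lebesgue_on X) \<and>
     (\<forall>x\<in>X. (\<integral>\<^sup>+ y. ennreal (S y x) \<partial>lebesgue_on Y) < \<infinity> \<or>
             (\<integral>\<^sup>+ y. ennreal (- S y x) \<partial>lebesgue_on Y) < \<infinity>)"

text \<open>
  The value lies in \<open>[0, \<infinity>]\<close>, so the supremum and the outer integral always exist.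
\<close>

definition signed_deficiency ::
    "'t set \<Rightarrow> 'a::euclidean_space set \<Rightarrow> 'b::euclidean_space set \<Rightarrow>
     ('a \<Rightarrow> 't \<Rightarrow> real) \<Rightarrow> ('b \<Rightarrow> 't \<Rightarrow> real) \<Rightarrow> ('b \<Rightarrow> 'a \<Rightarrow> real) \<Rightarrow> ennreal" where
  "signed_deficiency \<Theta> X Y u v S =
     (SUP \<theta>\<in>\<Theta>. 1 / 2 *
        (\<integral>\<^sup>+ y. ennreal \<bar>v y \<theta> - (\<integral>x. S y x * u x \<theta> \<partial>lebesgue_on X)\<bar> \<partial>lebesgue_on Y))"

definition unif_density :: "real \<Rightarrow> real \<Rightarrow> real" where
  "unif_density x \<theta> = indicator {\<theta> - 1/2 .. \<theta> + 1/2} x"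

text \<open>
  Differentiating within the parameter interval is the ordinary derivative at interior points and
  the one-sided derivative at the endpoints.
\<close>

definition grad_theta :: "('b \<Rightarrow> real \<Rightarrow> real) \<Rightarrow> 'b \<Rightarrow> real \<Rightarrow> real" where
  "grad_theta v y \<theta> = vector_derivative (v y) (at \<theta> within {-1/2..1/2})"

text \<open>
  The four cases are disjoint for \<open>x \<in> [-1, 1]\<close>, except for \<open>x = 0\<close> when \<open>\<theta>0 = -1/2\<close>;
  there the second case is used.
\<close>

definition kernel_star ::
    "('b \<Rightarrow> real \<Rightarrow> real) \<Rightarrow> real \<Rightarrow> ('b \<Rightarrow> real) \<Rightarrow> ('b \<Rightarrow> real) \<Rightarrow> 'b \<Rightarrow> real \<Rightarrow> real" where
  "kernel_star v \<theta>0 gplus gminus y x =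
     (if x \<le> \<theta>0 - 1/2 then gminus y
      else if x \<le> 0 then gplus y - grad_theta v y (x + 1/2)
      else if x < 1/2 + \<theta>0 then grad_theta v y (x - 1/2) + gminus y
      else gplus y)"

lemma density_model_unif: "density_model {-1/2..1/2} {-1..1} unif_density"
proof -
  have "has_bochner_integral (lebesgue_on {-1..1}) (\<lambda>x. unif_density x \<theta>) 1"
    if "\<theta> \<in> {-1/2..1/2}" for \<theta> :: real
  proof -
    have sub: "{\<theta> - 1/2..\<theta> + 1/2} \<subseteq> {-1..1}" using that by auto
    have "has_bochner_integral lebesgue (indicator {\<theta> - 1/2..\<theta> + 1/2} :: real \<Rightarrow> real)
            (measure lebesgue {\<theta> - 1/2..\<theta> + 1/2})"
      by (rule has_bochner_integral_real_indicator) auto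
    moreover have "indicator {-1..1} x *\<^sub>R unif_density x \<theta>
        = (indicator {\<theta> - 1/2..\<theta> + 1/2} x :: real)" for x
      using sub by (auto simp: unif_density_def indicator_def)
    ultimately show ?thesis
      by (simp add: has_bochner_integral_restrict_space)
  qed
  then show ?thesis
    by (auto simp: density_model_def unif_density_def)
qed

end

theory Submission
  imports Defs
begin

text \<open>
  For fixed \<open>y\<close> the claim is an identity for integrals over \<open>[\<theta> - 1/2, \<theta> + 1/2]\<close>. Splitting this interval
  at \<open>0\<close> and at whichever of \<open>\<theta>0 - 1/2\<close>, \<open>\<theta>0 + 1/2\<close> lies inside it, the fundamental theorem
  of calculus evaluates every piece, and the constraint on \<open>gplus\<close> and \<open>gminus\<close> makes the
  pieces add up to \<open>v y \<theta>\<close>. Only differentiability of \<open>v y\<close> is available, so the gradient is integrated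
  in the Henstock-Kurzweil sense; integrability of the kernel transfers the value to the
  Lebesgue integral.
\<close>

text \<open>The derivative is asked for only in the open interval. This disregards the values of the
  kernel at the case boundaries and the missing derivative of \<open>v y\<close> at
  \<open>\<theta>0\<close>; continuity of \<open>F\<close> covers the endpoints.\<close>

lemma has_integral_FTC_real:
  fixes F f :: "real \<Rightarrow> real"
  assumes "a \<le> b" and "continuous_on {a..b} F"
    and "\<And>x. x \<in> {a<..<b} \<Longrightarrow> (F has_real_derivative f x) (at x)"
    and "F b - F a = I"
  shows "(f has_integral I) {a..b}"
  using fundamental_theorem_of_calculus_interior[OF assms(1,2), of f] assms(3,4)
  by (simp add: has_real_derivative_iff_has_vector_derivative)

lemma grad_theta_DERIV:
  assumes "v y differentiable (at \<theta> within {-1/2..1/2})" and "\<theta> \<in> {-1/2<..<1/2}"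
  shows "(v y has_real_derivative grad_theta v y \<theta>) (at \<theta>)"
proof -
  have "(v y has_vector_derivative grad_theta v y \<theta>) (at \<theta> within {-1/2..1/2})"
    using assms(1) by (simp add: grad_theta_def vector_derivative_works[symmetric])
  moreover have "at \<theta> within {-1/2..1/2} = at \<theta>"
    using assms(2) by (intro at_within_interior) (simp add: interior_atLeastAtMost_real)
  ultimately show ?thesis
    by (simp add: has_real_derivative_iff_has_vector_derivative)
qed

lemma kernel_star_has_integral:
  fixes v :: "'b \<Rightarrow> real \<Rightarrow> real" and y :: 'b
  assumes \<theta>0: "\<theta>0 \<in> {-1/2..1/2}" and \<theta>: "\<theta> \<in> {-1/2..1/2}"
    and cont: "continuous_on {-1/2..1/2} (v y)"
    and diff: "\<And>\<theta>. \<theta> \<in> {-1/2..<\<theta>0} \<union> {\<theta>0<..1/2} \<Longrightarrow>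
                v y differentiable (at \<theta> within {-1/2..1/2})"
    and g: "gplus y * (1 - 2 * \<theta>0) + gminus y * (1 + 2 * \<theta>0)
              = 2 * v y (1/2) + 2 * v y (-1/2) - 2 * v y \<theta>0"
  shows "(kernel_star v \<theta>0 gplus gminus y has_integral v y \<theta>) {\<theta> - 1/2..\<theta> + 1/2}"
proof -
  let ?S = "kernel_star v \<theta>0 gplus gminus y"
  \<comment> \<open>As \<open>x\<close> runs through the open interval, \<open>x + 1/2\<close> runs
    through \<open>(t, 1/2)\<close>, to the right of \<open>\<theta>0\<close>: only the second case
    of the kernel occurs, and \<open>v y\<close> is differentiable there.\<close>
  have below: "(?S has_integral gplus y * (1/2 - t) - (v y (1/2) - v y t)) {t - 1/2..0}"
    if t: "\<theta>0 \<le> t" "t \<le> 1/2" for t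
  proof (rule has_integral_FTC_real[where F = "\<lambda>x. gplus y * x - v y (x + 1/2)"])
    show "continuous_on {t - 1/2..0} (\<lambda>x. gplus y * x - v y (x + 1/2))"
      by (intro continuous_intros continuous_on_compose2[OF cont]) (use t \<theta>0 in auto)
    fix x assume x: "x \<in> {t - 1/2<..<0}"
    then have "(v y has_real_derivative grad_theta v y (x + 1/2)) (at (x + 1/2))"
      using t \<theta>0 by (intro grad_theta_DERIV diff) auto
    then have "((\<lambda>x. v y (x + 1/2)) has_real_derivative grad_theta v y (x + 1/2)) (at x)"
      by (simp add: DERIV_shift)
    moreover have "?S x = gplus y - grad_theta v y (x + 1/2)"
      using x t by (simp add: kernel_star_def)
    ultimately show "((\<lambda>x. gplus y * x - v y (x + 1/2)) has_real_derivative ?S x) (at x)"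
      by (auto intro!: derivative_eq_intros)
  qed (use t in \<open>auto simp: algebra_simps\<close>)
  \<comment> \<open>Mirror image: \<open>x - 1/2\<close> runs through \<open>(-1/2, t)\<close>, to
    the left of \<open>\<theta>0\<close>, so only the third case occurs.\<close>
  have above: "(?S has_integral v y t - v y (-1/2) + gminus y * (t + 1/2)) {0..t + 1/2}"
    if t: "-1/2 \<le> t" "t \<le> \<theta>0" for t
  proof (rule has_integral_FTC_real[where F = "\<lambda>x. v y (x - 1/2) + gminus y * x"])
    show "continuous_on {0..t + 1/2} (\<lambda>x. v y (x - 1/2) + gminus y * x)"
      by (intro continuous_intros continuous_on_compose2[OF cont]) (use t \<theta>0 in auto)
    fix x assume x: "x \<in> {0<..<t + 1/2}"
    then have "(v y has_real_derivative grad_theta v y (x - 1/2)) (at (x - 1/2))"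
      using t \<theta>0 by (intro grad_theta_DERIV diff) auto
    then have "((\<lambda>x. v y (x - 1/2)) has_real_derivative grad_theta v y (x - 1/2)) (at x)"
      using DERIV_shift[of "v y" "grad_theta v y (x - 1/2)" x "-1/2"] by simp
    moreover have "?S x = grad_theta v y (x - 1/2) + gminus y"
      using x t \<theta>0 by (simp add: kernel_star_def)
    ultimately show "((\<lambda>x. v y (x - 1/2) + gminus y * x) has_real_derivative ?S x) (at x)"
      by (auto intro!: derivative_eq_intros)
  qed (use t in \<open>auto simp: algebra_simps\<close>)
  show ?thesis
  proof (cases "\<theta> \<le> \<theta>0")
    case True
    \<comment> \<open>The window begins in the region where the kernel is constantly
      \<open>gminus y\<close> and ends no later than \<open>\<theta>0 + 1/2\<close>.\<close>
    have "(?S has_integral gminus y * (\<theta>0 - \<theta>)) {\<theta> - 1/2..\<theta>0 - 1/2}"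
    proof (rule has_integral_FTC_real[where F = "\<lambda>x. gminus y * x"])
      fix x assume "x \<in> {\<theta> - 1/2<..<\<theta>0 - 1/2}"
      then show "((\<lambda>x. gminus y * x) has_real_derivative ?S x) (at x)"
        by (auto simp: kernel_star_def intro!: derivative_eq_intros)
    qed (use True in \<open>auto intro!: continuous_intros simp: algebra_simps\<close>)
    from has_integral_combine[OF _ _ this below[of \<theta>0]] True \<theta>0
    have "(?S has_integral gminus y * (\<theta>0 - \<theta>) +
        (gplus y * (1/2 - \<theta>0) - (v y (1/2) - v y \<theta>0))) {\<theta> - 1/2..0}"
      by simp
    from has_integral_combine[OF _ _ this above[of \<theta>]] True \<theta>
    have "(?S has_integral gminus y * (\<theta>0 - \<theta>) +
        (gplus y * (1/2 - \<theta>0) - (v y (1/2) - v y \<theta>0)) +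
        (v y \<theta> - v y (-1/2) + gminus y * (\<theta> + 1/2))) {\<theta> - 1/2..\<theta> + 1/2}"
      by simp
    \<comment> \<open>In the coefficient of \<open>gminus y\<close> the parameter
      \<open>\<theta>\<close> cancels, leaving \<open>\<theta>0 + 1/2\<close>; that of
      \<open>gplus y\<close> is \<open>1/2 - \<theta>0\<close>. Half of \<open>g\<close> then
      replaces both terms by \<open>v y (1/2) + v y (-1/2) - v y \<theta>0\<close>.\<close>
    moreover have "gminus y * (\<theta>0 - \<theta>) +
        (gplus y * (1/2 - \<theta>0) - (v y (1/2) - v y \<theta>0)) +
        (v y \<theta> - v y (-1/2) + gminus y * (\<theta> + 1/2)) = v y \<theta>"
      using g by (simp add: algebra_simps)
    ultimately show ?thesis by (simp only:)
  next
    case False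
    \<comment> \<open>Now the window starts to the right of \<open>\<theta>0 - 1/2\<close> and
      reaches past \<open>\<theta>0 + 1/2\<close>, where the kernel is constantly
      \<open>gplus y\<close>.\<close>
    have "(?S has_integral gplus y * (\<theta> - \<theta>0)) {\<theta>0 + 1/2..\<theta> + 1/2}"
    proof (rule has_integral_FTC_real[where F = "\<lambda>x. gplus y * x"])
      fix x assume "x \<in> {\<theta>0 + 1/2<..<\<theta> + 1/2}"
      then show "((\<lambda>x. gplus y * x) has_real_derivative ?S x) (at x)"
        using \<theta>0 by (auto simp: kernel_star_def intro!: derivative_eq_intros)
    qed (use False in \<open>auto intro!: continuous_intros simp: algebra_simps\<close>)
    with has_integral_combine[OF _ _ above[of \<theta>0] this] False \<theta>0
    have "(?S has_integral (v y \<theta>0 - v y (-1/2) + gminus y * (\<theta>0 + 1/2)) +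
        gplus y * (\<theta> - \<theta>0)) {0..\<theta> + 1/2}"
      by simp
    from has_integral_combine[OF _ _ below[of \<theta>] this] False \<theta>
    have "(?S has_integral (gplus y * (1/2 - \<theta>) - (v y (1/2) - v y \<theta>)) +
        ((v y \<theta>0 - v y (-1/2) + gminus y * (\<theta>0 + 1/2)) +
        gplus y * (\<theta> - \<theta>0))) {\<theta> - 1/2..\<theta> + 1/2}"
      by simp
    moreover have "(gplus y * (1/2 - \<theta>) - (v y (1/2) - v y \<theta>)) +
        ((v y \<theta>0 - v y (-1/2) + gminus y * (\<theta>0 + 1/2)) +
        gplus y * (\<theta> - \<theta>0)) = v y \<theta>"
      using g by (simp add: algebra_simps)
    ultimately show ?thesis by (simp only:)
  qed
qed

text \<open>Multiplying by the density restricts the integral to a window inside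
  \<open>{-1..1}\<close>. There \<open>f\<close> is Lebesgue integrable, so its Lebesgue integral is
  also a gauge integral, and uniqueness identifies it with \<open>I\<close>.\<close>

lemma integral_unif_density:
  fixes f :: "real \<Rightarrow> real"
  assumes \<theta>: "\<theta> \<in> {-1/2..1/2}"
    and f: "integrable (lebesgue_on {-1..1}) f"
    and I: "(f has_integral I) {\<theta> - 1/2..\<theta> + 1/2}"
  shows "(\<integral>x. f x * unif_density x \<theta> \<partial>lebesgue_on {-1..1}) = I"
proof -
  let ?A = "{\<theta> - 1/2..\<theta> + 1/2}"
  have sub: "?A \<subseteq> {-1..1}"
    using \<theta> by auto
  have "set_integrable lebesgue {-1..1} f"
    using f by (simp add: integrable_restrict_space set_integrable_def)
  then have int: "set_integrable lebesgue ?A f"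
    by (rule set_integrable_subset) (use sub in auto)
  have "(\<integral>x. f x * unif_density x \<theta> \<partial>lebesgue_on {-1..1})
      = (\<integral>x. indicator {-1..1} x *\<^sub>R (f x * unif_density x \<theta>) \<partial>lebesgue)"
    by (simp add: integral_restrict_space)
  also have "\<dots> = (LINT x:?A|lebesgue. f x)"
    unfolding set_lebesgue_integral_def
    by (rule Bochner_Integration.integral_cong) (use sub in \<open>auto simp: unif_density_def indicator_def\<close>)
  also have "\<dots> = I"
    using has_integral_unique[OF has_integral_set_lebesgue[OF int] I] .
  finally show ?thesis .
qed

theorem proposition4:
  fixes Y :: "'b::euclidean_space set"
    and v :: "'b \<Rightarrow> real \<Rightarrow> real"
    and \<theta>0 :: real
    and gplus gminus :: "'b \<Rightarrow> real"
  assumes "density_model {-1/2..1/2} Y v"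
    and "\<theta>0 \<in> {-1/2..1/2}"
    and "\<And>y. y \<in> Y \<Longrightarrow> continuous_on {-1/2..1/2} (v y)"
    and "\<And>y \<theta>. y \<in> Y \<Longrightarrow> \<theta> \<in> {-1/2..<\<theta>0} \<union> {\<theta>0<..1/2} \<Longrightarrow>
           v y differentiable (at \<theta> within {-1/2..1/2})"
    and "\<And>y. y \<in> Y \<Longrightarrow>
           gplus y * (1 - 2 * \<theta>0) + gminus y * (1 + 2 * \<theta>0)
             = 2 * v y (1/2) + 2 * v y (-1/2) - 2 * v y \<theta>0"
    and "signed_kernel {-1..1} Y (kernel_star v \<theta>0 gplus gminus)"
    and "\<And>y. y \<in> Y \<Longrightarrow> integrable (lebesgue_on {-1..1}) (kernel_star v \<theta>0 gplus gminus y)"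
  shows "signed_deficiency {-1/2..1/2} {-1..1} Y unif_density v (kernel_star v \<theta>0 gplus gminus) = 0"
proof -
  have "(\<integral>x. kernel_star v \<theta>0 gplus gminus y x * unif_density x \<theta> \<partial>lebesgue_on {-1..1}) = v y \<theta>"
    if "y \<in> Y" "\<theta> \<in> {-1/2..1/2}" for y \<theta>
    using that assms(2-5,7)
    by (intro integral_unif_density kernel_star_has_integral) auto
  \<comment> \<open>The integrand vanishes at every point of \<open>Y\<close>, so no null set has to
    be discarded.\<close>
  then have "(\<integral>\<^sup>+ y. ennreal \<bar>v y \<theta> - (\<integral>x. kernel_star v \<theta>0 gplus gminus y x * unif_density x \<theta>
      \<partial>lebesgue_on {-1..1})\<bar> \<partial>lebesgue_on Y) = (\<integral>\<^sup>+ y. 0 \<partial>lebesgue_on Y)"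
    if "\<theta> \<in> {-1/2..1/2}" for \<theta>
    using that by (intro nn_integral_cong) simp
  then show ?thesis
    by (simp add: signed_deficiency_def)
qed

end
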